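(* With the polynomials $P_{n,k}$, $Q_{n,k}^{(1,0,0)}$, $Q_{n,k}^{(0,1,0)}$, $Q_{n,k}^{(0,0,1)}$ defined in the context, the following identities of polynomials in $(x,y)$ hold. (i) $Q_{0,0}^{(1,0,0)}=P_{0,0}$; $(2n+1)\,Q_{n,k}^{(1,0,0)}=(n-k)\left[P_{n,k}+P_{n-1,k}\right]$ for $n\ge1$, $0\le k\le n-1$; $Q_{n,n}^{(1,0,0)}=P_{n,n}$. (ii) $(2n+1)\,Q_{n,0}^{(0,1,0)}=(n+1)P_{n,0}-n\,P_{n-1,0}$ for $n\ge 0$; $(2n+1)\,Q_{n,k}^{(0,1,0)}=(n+k+1)P_{n,k}-(n-k+1)P_{n,k-1}-(n-k)P_{n-1,k}+(n+k)P_{n-1,k-1}$ for $n\ge 1$, $1\le k\le n$. (iii) $(2n+1)\,Q_{n,0}^{(0,0,1)}=(n+1)P_{n,0}-n\,P_{n-1,0}$ for $n\ge 0$; $(2n+1)\,Q_{n,k}^{(0,0,1)}=-(n+k+1)P_{n,k}-(n-k+1)P_{n,k-1}+(n-k)P_{n-1,k}+(n+k)P_{n-1,k-1}$ for $n\ge 1$, $1\le k\le n$. (Terms whose coefficient is zero, namely those involving $P_{-1,0}$ or $P_{n-1,n}$, are read as zero.)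
   Context: Let $P_k^{(\alpha,\beta)}$ denote the classical degree-$k$ Jacobi polynomial on $[-1,1]$ (standard normalization $P_k^{(\alpha,\beta)}(1)=\binom{k+\alpha}{k}$), and let $\tilde P_k^{(\alpha,\beta)}(x)=P_k^{(\alpha,\beta)}(2x-1)$ be the shifted Jacobi polynomial on $[0,1]$. For $a,b,c>-1$ and integers $n\ge k\ge 0$ the Jacobi polynomials on the triangle are $$P_{n,k}^{(a,b,c)}(x,y)=\tilde P_{n-k}^{(2k+b+c+1,a)}(x)\,(1-x)^k\,\tilde P_k^{(c,b)}\!\left(\tfrac{y}{1-x}\right),$$ and $P_{n,k}:=P_{n,k}^{(0,0,0)}$. These are polynomials in $x,y$. Put $z:=1-x-y$. One-edge Dirichlet bases: - $Q_{0,0}^{(1,0,0)}:=1$; $Q_{n,k}^{(1,0,0)}:=x\,P_{n-1,k}^{(1,0,0)}$ for $0\le k\le n-1$; $Q_{n,n}^{(1,0,0)}:=P_{n,n}$. - $Q_{n,0}^{(0,1,0)}(x,y):=\tilde P_n^{(0,0)}(x)$; $Q_{n,k}^{(0,1,0)}:=y\,P_{n-1,k-1}^{(0,1,0)}$ for $1\le k\le n$. - $Q_{n,0}^{(0,0,1)}(x,y):=\tilde P_n^{(0,0)}(x)$; $Q_{n,k}^{(0,0,1)}:=z\,P_{n-1,k-1}^{(0,0,1)}$ for $1\le k\le n$.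
   Formalization: In (ii) and (iii), the four-term identities for 1 ≤ k ≤ n are proved with left-hand factor 2(2n+1) instead of (2n+1); as printed they fail, e.g. at n=k=1 the right sides are 6y and 6z while the left sides are 3y and 3z. *)

theory Defs
  imports "HOL-Computational_Algebra.Polynomial"
begin

text \<open>
  Classical Jacobi polynomial, expanded in powers of \<open>(t - 1)/2\<close> (Szego, (4.21.2)):
  \<open>P\<^sub>k(t) = (\<Sum>m\<le>k. binom(k+\<alpha>, k-m) binom(k+\<alpha>+\<beta>+m, m) ((t-1)/2)\<^sup>m)\<close>.
\<close>

definition jacobi :: "nat \<Rightarrow> real \<Rightarrow> real \<Rightarrow> real poly" where
  "jacobi k \<alpha> \<beta> = (\<Sum>m\<le>k.
     smult (((real k + \<alpha>) gchoose (k - m)) * ((real k + \<alpha> + \<beta> + real m) gchoose m))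
       ([:- 1 / 2, 1 / 2:] ^ m))"

lemma jacobi_at_1: "poly (jacobi k \<alpha> \<beta>) 1 = (real k + \<alpha>) gchoose k"
proof -
  have "poly (jacobi k \<alpha> \<beta>) 1 =
      (\<Sum>m\<le>k. if m = 0 then (real k + \<alpha>) gchoose k else 0)"
    unfolding jacobi_def poly_sum by (intro sum.cong) (auto simp: poly_power)
  then show ?thesis by simp
qed

lemma degree_jacobi_le: "degree (jacobi k \<alpha> \<beta>) \<le> k"
  unfolding jacobi_def
proof (intro degree_sum_le)
  fix m assume m: "m \<in> {..k}"
  have "degree ([:- 1 / 2, 1 / 2 :: real:] ^ m) \<le> m"
    using degree_power_le[of "[:- 1 / 2, 1 / 2 :: real:]" m] by simp
  then show "degree (smult (((real k + \<alpha>) gchoose (k - m)) *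
      ((real k + \<alpha> + \<beta> + real m) gchoose m)) ([:- 1 / 2, 1 / 2:] ^ m)) \<le> k"
    using m by (meson atMost_iff degree_smult_le order_trans)
qed simp

definition shifted_jacobi :: "nat \<Rightarrow> real \<Rightarrow> real \<Rightarrow> real poly" where
  "shifted_jacobi k \<alpha> \<beta> = pcompose (jacobi k \<alpha> \<beta>) [:- 1, 2:]"

lemma poly_shifted_jacobi: "poly (shifted_jacobi k \<alpha> \<beta>) x = poly (jacobi k \<alpha> \<beta>) (2 * x - 1)"
  by (simp add: shifted_jacobi_def poly_pcompose algebra_simps)

text \<open>
  A polynomial in \<open>(x, y)\<close> is a polynomial in \<open>y\<close> whose coefficients are polynomials in \<open>x\<close>:
  \<open>[:p:]\<close> is the univariate polynomial \<open>p(x)\<close> regarded as bivariate.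
\<close>

definition varX :: "real poly poly" where "varX = [:[:0, 1:]:]"
definition varY :: "real poly poly" where "varY = [:0, 1:]"
definition varZ :: "real poly poly" where "varZ = 1 - varX - varY"

definition eval2 :: "real poly poly \<Rightarrow> real \<Rightarrow> real \<Rightarrow> real" where
  "eval2 q x y = poly (poly q [:y:]) x"

text \<open>
  For \<open>degree p \<le> k\<close>, the polynomial \<open>(1-x)\<^sup>k p(y/(1-x))\<close>, i.e.
  \<open>\<Sum>j\<le>k. (coeff p j) (1-x)\<^bsup>k-j\<^esup> y\<^sup>j\<close>.
\<close>

definition homog :: "nat \<Rightarrow> real poly \<Rightarrow> real poly poly" where
  "homog k p = (\<Sum>j\<le>k. monom (smult (coeff p j) ([:1, - 1:] ^ (k - j))) j)"

lemma eval2_homog: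
  assumes "degree p \<le> k" "x \<noteq> 1"
  shows "eval2 (homog k p) x y = (1 - x) ^ k * poly p (y / (1 - x))"
proof -
  have "poly p (y / (1 - x)) = (\<Sum>j\<le>k. coeff p j * (y / (1 - x)) ^ j)"
    unfolding poly_altdef
    by (rule sum.mono_neutral_left) (use assms(1) in \<open>auto simp: coeff_eq_0\<close>)
  then have "(1 - x) ^ k * poly p (y / (1 - x)) =
      (\<Sum>j\<le>k. (1 - x) ^ k * (coeff p j * (y / (1 - x)) ^ j))"
    by (simp add: sum_distrib_left)
  also have "\<dots> = (\<Sum>j\<le>k. coeff p j * (1 - x) ^ (k - j) * y ^ j)"
    using assms(2) by (intro sum.cong) (auto simp: power_divide power_diff)
  also have "\<dots> = eval2 (homog k p) x y"
    by (simp add: eval2_def homog_def poly_sum poly_monom poly_power mult.assoc)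
  finally show ?thesis by simp
qed

text \<open>\<open>P\<^bsub>n,k\<^esub>\<^bsup>(a,b,c)\<^esup>\<close>; meaningful for \<open>k \<le> n\<close> and \<open>a, b, c > -1\<close>.\<close>

definition triP :: "nat \<Rightarrow> nat \<Rightarrow> real \<Rightarrow> real \<Rightarrow> real \<Rightarrow> real poly poly" where
  "triP n k a b c =
     [:shifted_jacobi (n - k) (2 * real k + b + c + 1) a:] * homog k (shifted_jacobi k c b)"

lemma degree_shifted_jacobi_le: "degree (shifted_jacobi k \<alpha> \<beta>) \<le> k"
  using degree_jacobi_le[of k \<alpha> \<beta>] by (simp add: shifted_jacobi_def degree_pcompose)

lemma eval2_triP:
  assumes "x \<noteq> 1"
  shows "eval2 (triP n k a b c) x y =
    poly (shifted_jacobi (n - k) (2 * real k + b + c + 1) a) x * (1 - x) ^ k *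
    poly (shifted_jacobi k c b) (y / (1 - x))"
  using eval2_homog[OF degree_shifted_jacobi_le assms, of k c b y]
  by (simp add: triP_def eval2_def)

abbreviation triP0 :: "nat \<Rightarrow> nat \<Rightarrow> real poly poly" where
  "triP0 n k \<equiv> triP n k 0 0 0"

definition Q100 :: "nat \<Rightarrow> nat \<Rightarrow> real poly poly" where
  "Q100 n k =
     (if n = 0 \<and> k = 0 then 1
      else if k = n then triP0 n n
      else varX * triP (n - 1) k 1 0 0)"

definition Q010 :: "nat \<Rightarrow> nat \<Rightarrow> real poly poly" where
  "Q010 n k =
     (if k = 0 then [:shifted_jacobi n 0 0:]
      else varY * triP (n - 1) (k - 1) 0 1 0)"

definition Q001 :: "nat \<Rightarrow> nat \<Rightarrow> real poly poly" where
  "Q001 n k =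
     (if k = 0 then [:shifted_jacobi n 0 0:]
      else varZ * triP (n - 1) (k - 1) 0 0 1)"

text \<open>
  The four-term relations for \<open>k \<ge> 1\<close> hold with the factor \<open>2(2n+1)\<close>, the \<open>2\<close> coming from
  \<open>2 s P\<^bsub>k-1\<^esub>\<^bsup>(0,1)\<^esup>(2s-1) = P\<^bsub>k\<^esub>\<^bsup>(0,0)\<^esup>(2s-1) + P\<^bsub>k-1\<^esub>\<^bsup>(0,0)\<^esup>(2s-1)\<close>
  and its mirror image.  With the factor \<open>2n+1\<close>, as printed in the source, they are false for
  the polynomials defined above; already at \<open>n = k = 1\<close> the right-hand sides are \<open>6y\<close> and
  \<open>6z\<close>, whereas \<open>(2n+1) Q\<close> is \<open>3y\<close> and \<open>3z\<close>.
\<close>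

lemma four_term_without_2_fails:
  shows "3 * Q010 1 1 \<noteq> 3 * triP0 1 1 - triP0 1 0 - 0 * triP0 0 1 + 2 * triP0 0 0"
    and "3 * Q001 1 1 \<noteq> - (3 * triP0 1 1) - triP0 1 0 + 0 * triP0 0 1 + 2 * triP0 0 0"
proof -
  have ev: "eval2 (p + q) x y = eval2 p x y + eval2 q x y"
    "eval2 (p - q) x y = eval2 p x y - eval2 q x y"
    "eval2 (- p) x y = - eval2 p x y"
    "eval2 (p * q) x y = eval2 p x y * eval2 q x y"
    "eval2 (numeral m) x y = numeral m" "eval2 0 x y = 0" "eval2 1 x y = 1"
    "eval2 varX x y = x" "eval2 varY x y = y" for p q x y m
    by (simp_all add: eval2_def varX_def varY_def)
  have J: "poly (shifted_jacobi 0 \<alpha> \<beta>) x = 1"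
    "poly (shifted_jacobi (Suc 0) \<alpha> \<beta>) x = 1 + \<alpha> + (2 + \<alpha> + \<beta>) * (x - 1)" for \<alpha> \<beta> x
    by (simp_all add: poly_shifted_jacobi jacobi_def field_simps)
  have "eval2 (3 * Q010 1 1) 0 1 \<noteq>
      eval2 (3 * triP0 1 1 - triP0 1 0 - 0 * triP0 0 1 + 2 * triP0 0 0) 0 1"
    by (simp add: Q010_def ev eval2_triP J)
  then show "3 * Q010 1 1 \<noteq> 3 * triP0 1 1 - triP0 1 0 - 0 * triP0 0 1 + 2 * triP0 0 0"
    by metis
  have "eval2 (3 * Q001 1 1) 0 0 \<noteq>
      eval2 (- (3 * triP0 1 1) - triP0 1 0 + 0 * triP0 0 1 + 2 * triP0 0 0) 0 0"
    by (simp add: Q001_def varZ_def ev eval2_triP J)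
  then show "3 * Q001 1 1 \<noteq> - (3 * triP0 1 1) - triP0 1 0 + 0 * triP0 0 1 + 2 * triP0 0 0"
    by metis
qed

end

theory Submission
  imports Defs
begin

text \<open>
  Writing \<open>s = y/(1-x)\<close>, every polynomial in sight is a product of a Jacobi polynomial in \<open>x\<close> and
  one in \<open>s\<close>.  Comparing the products reduces all relations to three classical contiguous
  relations between Jacobi polynomials, which hold coefficientwise in powers of \<open>x - 1\<close> by
  Pascal's rule and absorption for generalised binomial coefficients.
\<close>

section \<open>Contiguous relations for shifted Jacobi polynomials\<close>

text \<open>Both sides equal \<open>a * ((a - 1) gchoose j)\<close>, by the two absorption
  rules.\<close>

lemma gbinomial_Suc_step:
  "(1 + real j) * (a gchoose Suc j) = (a - real j) * (a gchoose j)" for a :: real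
  using gbinomial_absorption[of j a] gbinomial_absorb_comp[of a j] by simp

text \<open>The coefficient of \<open>(x - 1)^m\<close> in the shifted polynomial, since (t-1)/2 =
  x-1 at t = 2x-1. The value 0 beyond the degree lets polynomials of different degrees be compared
  at every index.\<close>

definition jacobi_coeff :: "nat \<Rightarrow> real \<Rightarrow> real \<Rightarrow> nat \<Rightarrow> real" where
  "jacobi_coeff k \<alpha> \<beta> m =
     (if m \<le> k then ((real k + \<alpha>) gchoose (k - m)) * ((real k + \<alpha> + \<beta> + real m) gchoose m) else 0)"

definition jacobi_taylor :: "nat \<Rightarrow> real \<Rightarrow> real \<Rightarrow> real poly" where
  "jacobi_taylor k \<alpha> \<beta> = (\<Sum>m\<le>k. monom (jacobi_coeff k \<alpha> \<beta> m) m)"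

lemma coeff_jacobi_taylor [simp]: "coeff (jacobi_taylor k \<alpha> \<beta>) m = jacobi_coeff k \<alpha> \<beta> m"
  by (simp add: jacobi_taylor_def coeff_sum jacobi_coeff_def)

lemma poly_shifted_jacobi_eq:
  "poly (shifted_jacobi k \<alpha> \<beta>) x = poly (jacobi_taylor k \<alpha> \<beta>) (x - 1)"
proof -
  have "(2 * x - 1) / 2 - 1 / 2 = x - 1"
    by (simp add: field_simps)
  then show ?thesis
    by (simp add: poly_shifted_jacobi jacobi_def jacobi_taylor_def poly_sum poly_monom jacobi_coeff_def)
qed

text \<open>In each coefficient, absorption reduces the second binomials to a common one; Pascal's
  rule and the one-step ratio then relate the first binomials.\<close>

lemma jacobi_lower_alpha:
  "(2 * real n + \<alpha> + \<beta> + 3) * poly (shifted_jacobi (Suc n) \<alpha> \<beta>) x =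
     (real n + \<alpha> + \<beta> + 2) * poly (shifted_jacobi (Suc n) (\<alpha> + 1) \<beta>) x
     - (real n + \<beta> + 1) * poly (shifted_jacobi n (\<alpha> + 1) \<beta>) x"
proof -
  have "smult (2 * real n + \<alpha> + \<beta> + 3) (jacobi_taylor (Suc n) \<alpha> \<beta>) =
     smult (real n + \<alpha> + \<beta> + 2) (jacobi_taylor (Suc n) (\<alpha> + 1) \<beta>)
     - smult (real n + \<beta> + 1) (jacobi_taylor n (\<alpha> + 1) \<beta>)" (is "?l = ?r")
  proof (rule poly_eqI)
    fix m
    \<comment> \<open>\<open>S\<close> is the upper argument of the second binomial both on the left
      and in the degree \<open>n\<close> term; the remaining term has \<open>S + 1\<close>.\<close>
    define S where "S = real n + 1 + \<alpha> + \<beta> + real m"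
    have S: "(real n + \<alpha> + \<beta> + 2) * ((S + 1) gchoose m) = (S + 1) * (S gchoose m)"
      using gbinomial_absorb_comp[of "S + 1" m] by (simp add: S_def algebra_simps)
    consider "m > Suc n" | "m = Suc n" | "m \<le> n" by linarith
    then show "coeff ?l m = coeff ?r m"
    proof cases
      case 2
      then show ?thesis using S by (simp add: jacobi_coeff_def S_def algebra_simps)
    next
      case 3
      define j where "j = n - m"
      have n: "real n = real j + real m" and j: "Suc n - m = Suc j" "n - m = j"
        using 3 by (auto simp: j_def)
      define a where "a = real n + 1 + \<alpha>"
      define g where "g = a gchoose j"
      define g' where "g' = a gchoose Suc j"
      have g: "(1 + real j) * g' = (\<alpha> + 1 + real m) * g"
        using gbinomial_Suc_step[of j a] by (simp add: g_def g'_def a_def n)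
      have "coeff ?l m = (2 * real n + \<alpha> + \<beta> + 3) * g' * (S gchoose m)"
        using 3 by (simp add: jacobi_coeff_def j g'_def a_def S_def algebra_simps)
      \<comment> \<open>As \<open>2 * n + \<alpha> + \<beta> + 3 - (S + 1) = 1 + j\<close> and
        \<open>S + 1 - (n + \<beta> + 1) = \<alpha> + 1 + m\<close>, this is fact \<open>g\<close>
        times \<open>S gchoose m\<close>.\<close>
      also have "\<dots> = ((S + 1) * (g + g') - (real n + \<beta> + 1) * g) * (S gchoose m)"
        using g by (simp add: S_def n) algebra
      also have "\<dots> = (g + g') * ((real n + \<alpha> + \<beta> + 2) * ((S + 1) gchoose m))
          - (real n + \<beta> + 1) * g * (S gchoose m)"
        unfolding S by algebra
      also have "\<dots> = coeff ?r m"
      proof -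
        have "g + g' = (a + 1) gchoose Suc j"
          by (simp add: g_def g'_def gbinomial_Suc_Suc)
        then show ?thesis
          using 3 by (simp add: jacobi_coeff_def j g_def a_def S_def algebra_simps)
      qed
      finally show ?thesis .
    qed (simp add: jacobi_coeff_def)
  qed
  from arg_cong[OF this, of "\<lambda>p. poly p (x - 1)"] show ?thesis
    by (simp add: poly_shifted_jacobi_eq)
qed

lemma jacobi_one_minus_times:
  "(2 * real n + \<alpha> + \<beta> + 2) * (1 - x) * poly (shifted_jacobi n (\<alpha> + 1) \<beta>) x =
     (real n + \<alpha> + 1) * poly (shifted_jacobi n \<alpha> \<beta>) x
     - (real n + 1) * poly (shifted_jacobi (Suc n) \<alpha> \<beta>) x"
proof -
  \<comment> \<open>In powers of \<open>x - 1\<close>, multiplying by \<open>1 - x\<close> is a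
    negated index shift.\<close>
  have "- smult (2 * real n + \<alpha> + \<beta> + 2) (pCons 0 (jacobi_taylor n (\<alpha> + 1) \<beta>)) =
     smult (real n + \<alpha> + 1) (jacobi_taylor n \<alpha> \<beta>)
     - smult (real n + 1) (jacobi_taylor (Suc n) \<alpha> \<beta>)" (is "?l = ?r")
  proof (rule poly_eqI)
    fix m
    define a where "a = real n + 1 + \<alpha>"
    have a: "a * ((a - 1) gchoose j) = (1 + real j) * (a gchoose Suc j)" for j
      using gbinomial_absorption[of j a] by simp
    show "coeff ?l m = coeff ?r m"
    proof (cases m)
      case 0
      \<comment> \<open>The shifted side has no constant term; on the right the two values at x = 1
        cancel by absorption.\<close>
      then show ?thesis using a[of n] by (simp add: jacobi_coeff_def a_def algebra_simps)
    next
      case (Suc i)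
      \<comment> \<open>Because of the shift, the left side has \<open>S gchoose i\<close> with
        \<open>i = m - 1\<close>; the right side has \<open>S gchoose m\<close> and, by Pascal, the
        sum of the two.\<close>
      define S where "S = real n + \<alpha> + \<beta> + real m"
      define h where "h = S gchoose i"
      define h' where "h' = S gchoose m"
      have h: "real m * h' = (real n + \<alpha> + \<beta> + 1) * h"
        using gbinomial_Suc_step[of i S] by (simp add: h_def h'_def S_def Suc algebra_simps)
      have hh: "(S + 1) gchoose m = h + h'"
        by (simp add: h_def h'_def Suc gbinomial_Suc_Suc)
      consider "m > Suc n" | "m = Suc n" | "m \<le> n" by linarith
      then show ?thesis
      proof cases
        case 1
        then show ?thesis by (simp add: jacobi_coeff_def Suc)
      next
        case 2
        have "coeff ?l m = - ((2 * real n + \<alpha> + \<beta> + 2) * h)"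
          using 2 by (simp add: jacobi_coeff_def Suc h_def S_def algebra_simps)
        also have "\<dots> = - ((real n + 1) * (h + h'))"
          using h 2 by (simp add: algebra_simps)
        also have "\<dots> = coeff ?r m"
          using 2 hh by (simp add: jacobi_coeff_def S_def algebra_simps)
        finally show ?thesis .
      next
        case 3
        define j where "j = n - m"
        have n: "real n = real j + real m" and j: "Suc n - m = Suc j" "n - m = j" "n - i = Suc j"
          using 3 by (auto simp: j_def Suc)
        define g where "g = a gchoose Suc j"
        have "coeff ?l m = - ((2 * real n + \<alpha> + \<beta> + 2) * g * h)"
          using 3 by (simp add: jacobi_coeff_def Suc h_def S_def a_def g_def j[unfolded Suc] algebra_simps)
        also have "\<dots> = (1 + real j) * g * h' - (real n + 1) * g * (h + h')"
          using h by (simp add: n) algebra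
        also have "\<dots> = coeff ?r m"
        proof -
          have "(real n + \<alpha> + 1) * ((real n + \<alpha>) gchoose j) = (1 + real j) * g"
            using a[of j] by (simp add: a_def g_def algebra_simps)
          moreover have "coeff ?r m = (real n + \<alpha> + 1) * ((real n + \<alpha>) gchoose j) * h'
              - (real n + 1) * g * ((S + 1) gchoose m)"
            using 3 by (simp add: jacobi_coeff_def S_def h'_def a_def g_def j algebra_simps)
          ultimately show ?thesis using hh by simp
        qed
        finally show ?thesis .
      qed
    qed
  qed
  from arg_cong[OF this, of "\<lambda>p. poly p (x - 1)"] show ?thesis
    by (simp add: poly_shifted_jacobi_eq algebra_simps)
qed

text \<open>The mirror image of \<open>jacobi_one_minus_times\<close> under x -> 1-x with the
  parameters exchanged. The coefficient comparison uses x = 1 + (x-1), so the left side is a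
  polynomial plus its own shift.\<close>

lemma jacobi_var_times:
  "(2 * real n + \<alpha> + \<beta> + 2) * x * poly (shifted_jacobi n \<alpha> (\<beta> + 1)) x =
     (real n + 1) * poly (shifted_jacobi (Suc n) \<alpha> \<beta>) x
     + (real n + \<beta> + 1) * poly (shifted_jacobi n \<alpha> \<beta>) x"
proof -
  have "smult (2 * real n + \<alpha> + \<beta> + 2)
        (jacobi_taylor n \<alpha> (\<beta> + 1) + pCons 0 (jacobi_taylor n \<alpha> (\<beta> + 1))) =
     smult (real n + 1) (jacobi_taylor (Suc n) \<alpha> \<beta>)
     + smult (real n + \<beta> + 1) (jacobi_taylor n \<alpha> \<beta>)" (is "?l = ?r")
  proof (rule poly_eqI)
    fix m
    define a where "a = real n + \<alpha>"
    define T where "T = real n + \<alpha> + \<beta> + real m"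
    define q where "q = T gchoose m"
    \<comment> \<open>Reads \<open>T gchoose (m - 1)\<close> as 0 at \<open>m = 0\<close>, so that
      Pascal's rule holds at every \<open>m\<close>.\<close>
    define p where "p = (case m of 0 \<Rightarrow> 0 | Suc i \<Rightarrow> T gchoose i)"
    have pq: "(T + 1) gchoose m = p + q"
      by (cases m) (simp_all add: p_def q_def gbinomial_Suc_Suc)
    have mq: "real m * q = (real n + \<alpha> + \<beta> + 1) * p"
    proof (cases m)
      case (Suc i)
      then show ?thesis using gbinomial_Suc_step[of i T]
        by (simp add: p_def q_def T_def algebra_simps)
    qed (simp add: p_def)
    consider "m > Suc n" | "m = Suc n" | "m \<le> n" by linarith
    then show "coeff ?l m = coeff ?r m"
    proof cases
      case 1
      then show ?thesis by (cases m) (simp_all add: jacobi_coeff_def)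
    next
      case 2
      have "coeff ?l m = (2 * real n + \<alpha> + \<beta> + 2) * p"
        using 2 by (simp add: jacobi_coeff_def p_def T_def algebra_simps)
      also have "\<dots> = (real n + 1) * (p + q)"
        using mq 2 by (simp add: algebra_simps)
      also have "\<dots> = coeff ?r m"
        using 2 pq by (simp add: jacobi_coeff_def T_def algebra_simps)
      finally show ?thesis .
    next
      case 3
      define j where "j = n - m"
      have n: "real n = real j + real m" and j: "Suc n - m = Suc j" "n - m = j"
        using 3 by (auto simp: j_def)
      define g where "g = a gchoose j"
      define g' where "g' = a gchoose Suc j"
      have g: "(1 + real j) * g' = (\<alpha> + real m) * g"
        using gbinomial_Suc_step[of j a] by (simp add: g_def g'_def a_def n algebra_simps)
      have gg: "(a + 1) gchoose Suc j = g + g'"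
        by (simp add: g_def g'_def gbinomial_Suc_Suc)
      have shift: "coeff (pCons 0 (jacobi_taylor n \<alpha> (\<beta> + 1))) m = g' * p"
      proof (cases m)
        case (Suc i)
        moreover have "n - i = Suc j" using 3 Suc by (simp add: j_def)
        ultimately show ?thesis
          using 3 by (simp add: jacobi_coeff_def p_def g'_def a_def T_def algebra_simps)
      qed (simp add: p_def)
      have "coeff ?l m = (2 * real n + \<alpha> + \<beta> + 2) * (g * (p + q) + g' * p)"
        using 3 unfolding coeff_smult coeff_add shift pq[symmetric]
        by (simp add: jacobi_coeff_def j g_def a_def T_def algebra_simps)
      \<comment> \<open>By \<open>mq\<close> the difference of the two sides is
        \<open>q * ((\<alpha> + m) * g - (1 + j) * g')\<close>, which vanishes by
        \<open>g\<close>.\<close>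
      also have "\<dots> = (real n + 1) * ((g + g') * (p + q)) + (real n + \<beta> + 1) * (g * q)"
        using g mq by (simp add: n) algebra
      also have "\<dots> = coeff ?r m"
        using 3 unfolding gg[symmetric] pq[symmetric]
        by (simp add: jacobi_coeff_def j g_def a_def T_def q_def algebra_simps)
      finally show ?thesis .
    qed
  qed
  from arg_cong[OF this, of "\<lambda>p. poly p (x - 1)"] show ?thesis
    by (simp add: poly_shifted_jacobi_eq algebra_simps)
qed

text \<open>Covers \<open>n = 0\<close> as well, where \<open>n - 1\<close> truncates but its factor
  is zero.\<close>

lemma jacobi_lower_alpha_0:
  "(2 * real n + \<alpha> + 1) * poly (shifted_jacobi n \<alpha> 0) x =
     (real n + \<alpha> + 1) * poly (shifted_jacobi n (\<alpha> + 1) 0) x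
     - real n * poly (shifted_jacobi (n - 1) (\<alpha> + 1) 0) x"
proof (cases n)
  case 0
  then show ?thesis by (simp add: poly_shifted_jacobi jacobi_def)
next
  case (Suc i)
  then show ?thesis using jacobi_lower_alpha[of i \<alpha> 0 x] by (simp add: algebra_simps)
qed

section \<open>Bivariate polynomials as functions\<close>

lemma eval2_simps [simp]:
  "eval2 (p + q) x y = eval2 p x y + eval2 q x y"
  "eval2 (p - q) x y = eval2 p x y - eval2 q x y"
  "eval2 (- p) x y = - eval2 p x y"
  "eval2 (p * q) x y = eval2 p x y * eval2 q x y"
  "eval2 (numeral w) x y = numeral w" "eval2 0 x y = 0" "eval2 1 x y = 1"
  "eval2 (of_nat n) x y = real n" "eval2 [:r:] x y = poly r x"
  "eval2 varX x y = x" "eval2 varY x y = y" "eval2 varZ x y = 1 - x - y"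
  by (simp_all add: eval2_def varX_def varY_def varZ_def of_nat_poly)

text \<open>The line x = 1, where y/(1-x) is undefined, may be left out: a nonzero coefficient of
  the difference, as a polynomial in x, has finitely many roots, so some x other than 1 avoids them.
  At that x the difference vanishes for all y, a contradiction.\<close>

lemma eval2_eqI:
  assumes "\<And>x y. x \<noteq> 1 \<Longrightarrow> eval2 p x y = eval2 q x y"
  shows "p = q"
proof (rule poly_eqI, rule ccontr)
  fix j
  define r where "r = p - q"
  assume "coeff p j \<noteq> coeff q j"
  then have "finite {x. poly (coeff r j) x = 0}"
    by (intro poly_roots_finite) (simp add: r_def)
  then obtain x where x: "x \<notin> insert 1 {x. poly (coeff r j) x = 0}"
    by (metis ex_new_if_finite finite_insert infinite_UNIV_char_0)
  \<comment> \<open>\<open>eval2\<close> substitutes y first; here x is specialised first, leaving a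
    univariate polynomial in y.\<close>
  have "poly (map_poly (\<lambda>c. poly c x) r) y = eval2 r x y" for y
    unfolding eval2_def
    by (induction r) (simp_all add: map_poly_pCons)
  also have "eval2 r x y = 0" for y
    using assms x by (simp add: r_def)
  finally have "map_poly (\<lambda>c. poly c x) r = 0"
    using poly_all_0_iff_0 by blast
  then have "poly (coeff r j) x = 0"
    by (metis coeff_0 coeff_map_poly poly_0)
  then show False using x by simp
qed

section \<open>The basis relations\<close>

text \<open>The s-factors agree, and the factor x lowers the second parameter of the x-factor from 1
  to 0. At degree \<open>m = n - k - 1\<close> and first parameter \<open>2 * k + 1\<close> the
  constants become \<open>2 * n + 1\<close> and \<open>n - k\<close>.\<close>

lemma Q100_relation:
  assumes "k < n"
  shows "of_nat (2 * n + 1) * Q100 n k = of_nat (n - k) * (triP0 n k + triP0 (n - 1) k)"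
proof (rule eval2_eqI)
  fix x y :: real assume x: "x \<noteq> 1"
  obtain m where n: "n = Suc (k + m)" using assms less_imp_Suc_add by blast
  show "eval2 (of_nat (2 * n + 1) * Q100 n k) x y =
        eval2 (of_nat (n - k) * (triP0 n k + triP0 (n - 1) k)) x y"
    using arg_cong[OF jacobi_var_times[of m "2 * real k + 1" 0 x],
        of "\<lambda>u. u * ((1 - x) ^ k * poly (shifted_jacobi k 0 0) (y / (1 - x)))"]
    by (simp add: Q100_def n eval2_triP[OF x] Suc_diff_le algebra_simps)
qed

lemma one_edge_0_relation:
  "of_nat (2 * n + 1) * [:shifted_jacobi n 0 0:] =
     of_nat (n + 1) * triP0 n 0 - of_nat n * triP0 (n - 1) 0"
proof (rule eval2_eqI)
  fix x y :: real assume x: "x \<noteq> 1"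
  have "poly (shifted_jacobi 0 0 0) (y / (1 - x)) = 1"
    by (simp add: poly_shifted_jacobi jacobi_def)
  then show "eval2 (of_nat (2 * n + 1) * [:shifted_jacobi n 0 0:]) x y =
        eval2 (of_nat (n + 1) * triP0 n 0 - of_nat n * triP0 (n - 1) 0) x y"
    using jacobi_lower_alpha_0[of n 0 x]
    unfolding eval2_simps by (simp add: eval2_triP[OF x] algebra_simps)
qed

text \<open>Groups the four terms by second index. Lowering the first parameter from
  \<open>2 * k + 1\<close> (index \<open>k\<close>), or raising it from \<open>2 * k - 1\<close> at
  the cost of a factor 1-x (index \<open>k - 1\<close>), gives the same x-factor with parameter
  \<open>2 * k\<close>.\<close>

lemma eval2_triP0_combination:
  assumes "x \<noteq> 1" "1 \<le> k" "k \<le> n"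
  shows "real (n + k + 1) * eval2 (triP0 n k) x y - real (n - k) * eval2 (triP0 (n - 1) k) x y =
      real (2 * n + 1) * poly (shifted_jacobi (n - k) (2 * real k) 0) x * (1 - x) ^ k
        * poly (shifted_jacobi k 0 0) (y / (1 - x))" (is ?upper)
    and "real (n + k) * eval2 (triP0 (n - 1) (k - 1)) x y
        - real (n - k + 1) * eval2 (triP0 n (k - 1)) x y =
      real (2 * n + 1) * poly (shifted_jacobi (n - k) (2 * real k) 0) x * (1 - x) ^ k
        * poly (shifted_jacobi (k - 1) 0 0) (y / (1 - x))" (is ?lower)
proof -
  obtain m where n: "n = k + m" using assms(3) le_Suc_ex by blast
  obtain i where k: "k = Suc i" using assms(2) by (cases k) auto
  \<comment> \<open>For \<open>k = n\<close> both differences truncate to 0, and the term has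
    coefficient zero.\<close>
  have m: "n - 1 - k = m - 1" by (simp add: n)
  show ?upper
    using arg_cong[OF jacobi_lower_alpha_0[of m "2 * real k" x],
        of "\<lambda>u. u * ((1 - x) ^ k * poly (shifted_jacobi k 0 0) (y / (1 - x)))"]
    unfolding eval2_triP[OF assms(1)] m by (simp add: n algebra_simps)
  show ?lower
    using arg_cong[OF jacobi_one_minus_times[of m "2 * real k - 1" 0 x],
        of "\<lambda>u. u * ((1 - x) ^ i * poly (shifted_jacobi i 0 0) (y / (1 - x)))"]
    unfolding eval2_triP[OF assms(1)] by (simp add: n k algebra_simps)
qed

text \<open>The edge polynomial has the x-factor \<open>J\<close> of the grouped terms, and y =
  (1-x)s supplies the missing power of 1-x. The factor s splits the s-factor into degrees
  \<open>k\<close> and \<open>k - 1\<close>, matching the two groups.\<close>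

lemma Q010_relation:
  assumes "1 \<le> k" "k \<le> n"
  shows "2 * of_nat (2 * n + 1) * Q010 n k =
            of_nat (n + k + 1) * triP0 n k - of_nat (n - k + 1) * triP0 n (k - 1)
            - of_nat (n - k) * triP0 (n - 1) k + of_nat (n + k) * triP0 (n - 1) (k - 1)"
    (is "?l = ?r")
proof (rule eval2_eqI)
  fix x y :: real assume x: "x \<noteq> 1"
  define s where "s = y / (1 - x)"
  have y: "y = (1 - x) * s" using x by (simp add: s_def)
  obtain i where k: "k = Suc i" using assms(1) by (cases k) auto
  define J where "J = poly (shifted_jacobi (n - k) (2 * real k) 0) x"
  \<comment> \<open>With both parameters 0, all constants in \<open>jacobi_var_times\<close> are
    multiples of \<open>1 + i\<close>; cancelling it leaves the 2.\<close>
  have "(1 + real i) * (2 * (s * poly (shifted_jacobi i 0 1) s)) =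
      (1 + real i) * (poly (shifted_jacobi k 0 0) s + poly (shifted_jacobi i 0 0) s)"
    using jacobi_var_times[of i 0 0 s] by (simp add: k algebra_simps)
  then have B: "2 * (s * poly (shifted_jacobi i 0 1) s) =
      poly (shifted_jacobi k 0 0) s + poly (shifted_jacobi i 0 0) s"
    by (subst (asm) mult_left_cancel) auto
  have "eval2 (Q010 n k) x y =
      J * (1 - x) ^ k * (s * poly (shifted_jacobi i 0 1) s)"
    using assms unfolding J_def
    by (simp add: Q010_def k eval2_triP[OF x] flip: s_def) (simp add: y algebra_simps)
  then have "eval2 ?l x y = real (2 * n + 1) * J * (1 - x) ^ k *
      (2 * (s * poly (shifted_jacobi i 0 1) s))"
    by simp
  also have "\<dots> = eval2 ?r x y"
    using eval2_triP0_combination[OF x assms, of y]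
    unfolding B J_def s_def[symmetric] by (simp add: k algebra_simps)
  finally show "eval2 ?l x y = eval2 ?r x y" .
qed

text \<open>As for the y-edge, with z = (1-x)(1-s): the factor 1-s now lowers the first parameter of
  the s-factor, and the degree \<open>k\<close> group enters with a minus sign.\<close>

lemma Q001_relation:
  assumes "1 \<le> k" "k \<le> n"
  shows "2 * of_nat (2 * n + 1) * Q001 n k =
            - (of_nat (n + k + 1) * triP0 n k) - of_nat (n - k + 1) * triP0 n (k - 1)
            + of_nat (n - k) * triP0 (n - 1) k + of_nat (n + k) * triP0 (n - 1) (k - 1)"
    (is "?l = ?r")
proof (rule eval2_eqI)
  fix x y :: real assume x: "x \<noteq> 1"
  define s where "s = y / (1 - x)"
  have z: "1 - x - y = (1 - x) * (1 - s)" using x by (simp add: s_def field_simps)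
  obtain i where k: "k = Suc i" using assms(1) by (cases k) auto
  define J where "J = poly (shifted_jacobi (n - k) (2 * real k) 0) x"
  have "(1 + real i) * (2 * ((1 - s) * poly (shifted_jacobi i 1 0) s)) =
      (1 + real i) * (poly (shifted_jacobi i 0 0) s - poly (shifted_jacobi k 0 0) s)"
    using jacobi_one_minus_times[of i 0 0 s] by (simp add: k algebra_simps)
  then have B: "2 * ((1 - s) * poly (shifted_jacobi i 1 0) s) =
      poly (shifted_jacobi i 0 0) s - poly (shifted_jacobi k 0 0) s"
    by (subst (asm) mult_left_cancel) auto
  have "eval2 (Q001 n k) x y =
      J * (1 - x) ^ k * ((1 - s) * poly (shifted_jacobi i 1 0) s)"
    using assms unfolding J_def
    by (simp add: Q001_def k eval2_triP[OF x] z flip: s_def)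
  then have "eval2 ?l x y = real (2 * n + 1) * J * (1 - x) ^ k *
      (2 * ((1 - s) * poly (shifted_jacobi i 1 0) s))"
    by simp
  also have "\<dots> = eval2 ?r x y"
    using eval2_triP0_combination[OF x assms, of y]
    unfolding B J_def s_def[symmetric] by (simp add: k algebra_simps)
  finally show "eval2 ?l x y = eval2 ?r x y" .
qed

lemma triP0_0_0: "triP0 0 0 = 1"
  by (rule eval2_eqI) (simp add: eval2_triP poly_shifted_jacobi jacobi_def)

theorem corollaryC1:
  shows
    "(Q100 0 0 = triP0 0 0
     \<and> (\<forall>n k. n \<ge> 1 \<and> k \<le> n - 1 \<longrightarrow>
          of_nat (2 * n + 1) * Q100 n k = of_nat (n - k) * (triP0 n k + triP0 (n - 1) k))
     \<and> (\<forall>n. Q100 n n = triP0 n n))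
   \<and> ((\<forall>n. of_nat (2 * n + 1) * Q010 n 0 = of_nat (n + 1) * triP0 n 0 - of_nat n * triP0 (n - 1) 0)
     \<and> (\<forall>n k. n \<ge> 1 \<and> 1 \<le> k \<and> k \<le> n \<longrightarrow>
          2 * of_nat (2 * n + 1) * Q010 n k =
            of_nat (n + k + 1) * triP0 n k - of_nat (n - k + 1) * triP0 n (k - 1)
            - of_nat (n - k) * triP0 (n - 1) k + of_nat (n + k) * triP0 (n - 1) (k - 1)))
   \<and> ((\<forall>n. of_nat (2 * n + 1) * Q001 n 0 = of_nat (n + 1) * triP0 n 0 - of_nat n * triP0 (n - 1) 0)
     \<and> (\<forall>n k. n \<ge> 1 \<and> 1 \<le> k \<and> k \<le> n \<longrightarrow>
          2 * of_nat (2 * n + 1) * Q001 n k =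
            - (of_nat (n + k + 1) * triP0 n k) - of_nat (n - k + 1) * triP0 n (k - 1)
            + of_nat (n - k) * triP0 (n - 1) k + of_nat (n + k) * triP0 (n - 1) (k - 1)))"
proof (intro conjI allI impI)
  show "Q100 0 0 = triP0 0 0"
    by (simp add: Q100_def triP0_0_0)
  show "Q100 n n = triP0 n n" for n
    by (simp add: Q100_def triP0_0_0)
  show "of_nat (2 * n + 1) * Q010 n 0 = of_nat (n + 1) * triP0 n 0 - of_nat n * triP0 (n - 1) 0"
    and "of_nat (2 * n + 1) * Q001 n 0 = of_nat (n + 1) * triP0 n 0 - of_nat n * triP0 (n - 1) 0"
    for n
    using one_edge_0_relation[of n] by (simp_all only: Q010_def Q001_def simp_thms if_True)
\<comment> \<open>For \<open>n \<ge> 1\<close>, the bound \<open>k \<le> n - 1\<close> means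
  \<open>k < n\<close>.\<close>
qed (simp_all only: Q010_relation Q001_relation, rule Q100_relation, linarith)

end
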